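(* Let $\alpha_i,\beta_i,\gamma_i\in\mathbb{C}$ ($i=0,1,2$) with $(\gamma_1,\gamma_2)\neq(0,0)$ be such that $$f(x_1,x_2)=\left(\alpha_0+\alpha_1x_1+\alpha_2x_2,\ \frac{\beta_0+\beta_1x_1+\beta_2x_2}{\gamma_0+\gamma_1x_1+\gamma_2x_2}\right)$$ is birational, and suppose $\beta_1\gamma_2-\beta_2\gamma_1=0$ and $\gamma_1\gamma_2\neq0$. Let $F$ be its extension to $\mathbb{P}^2(\mathbb{C})$, $d_n=\deg(F^n)$, and $\delta(F)$ its dynamical degree. Then one of the following holds: (i) $\alpha_1\neq0\neq\alpha_2$, and $\delta(F)=2$ with $d_n=2^n$ for all $n\in\mathbb{N}$. (ii) $\alpha_1=0$, and the dynamical degree is $\delta(F)=\delta^*:=\frac{1+\sqrt5}{2}$ with $d_{n+2}=d_{n+1}+d_n$ for all $n\in\mathbb{N}$. (iii) $\alpha_2=0$, and the dynamical degree is $\delta(F)=1$ with $d_n=1+n$ for all $n\in\mathbb{N}$.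
   Context: A map $f:\mathbb{C}^2\to\mathbb{C}^2$ with rational components is birational if there exist an algebraic curve $V$ and a rational map $g$ with $f\circ g=g\circ f=\mathrm{id}$ on $\mathbb{C}^2\setminus V$. Via the embedding $(x_1,x_2)\mapsto[1:x_1:x_2]$, $f$ induces $F:\mathbb{P}^2(\mathbb{C})\to\mathbb{P}^2(\mathbb{C})$, $F=[F_1:F_2:F_3]$ with $F_1=x_0(\gamma_0x_0+\gamma_1x_1+\gamma_2x_2)$, $F_2=(\alpha_0x_0+\alpha_1x_1+\alpha_2x_2)(\gamma_0x_0+\gamma_1x_1+\gamma_2x_2)$, $F_3=x_0(\beta_0x_0+\beta_1x_1+\beta_2x_2)$. The degree $d_n=\deg(F^n)$ of the iterate $F^n=F\circ\cdots\circ F$ is the common degree of its homogeneous components after removing common factors. The dynamical degree is $\delta(F)=\lim_{n\to\infty}(\deg(F^n))^{1/n}$. *)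

theory Defs
  imports "HOL-Computational_Algebra.Computational_Algebra"
    "HOL-Computational_Algebra.Field_as_Ring"
begin

section \<open>Rational self-maps of the affine plane\<close>

text \<open>\<open>\<complex>[x\<^sub>1][x\<^sub>2]\<close>: the outermost variable is \<open>x\<^sub>2\<close>.\<close>
type_synonym poly2 = "complex poly poly"

definition eval2 :: "poly2 \<Rightarrow> complex \<times> complex \<Rightarrow> complex" where
  "eval2 p x = poly (poly p [:snd x:]) (fst x)"

definition algebraic_curve :: "(complex \<times> complex) set \<Rightarrow> bool" where
  "algebraic_curve V \<longleftrightarrow> (\<exists>p :: poly2. (\<forall>c. p \<noteq> [:[:c:]:]) \<and> V = {x. eval2 p x = 0})"

text \<open>A rational function is a fraction (numerator, denominator), not necessarily reduced.\<close>
type_synonym ratfun2 = "poly2 \<times> poly2"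
type_synonym ratmap2 = "ratfun2 \<times> ratfun2"

definition rational_map :: "ratmap2 \<Rightarrow> bool" where
  "rational_map f \<longleftrightarrow> snd (fst f) \<noteq> 0 \<and> snd (snd f) \<noteq> 0"

definition regular_at :: "ratmap2 \<Rightarrow> complex \<times> complex \<Rightarrow> bool" where
  "regular_at f x \<longleftrightarrow> eval2 (snd (fst f)) x \<noteq> 0 \<and> eval2 (snd (snd f)) x \<noteq> 0"

definition ratmap_apply :: "ratmap2 \<Rightarrow> complex \<times> complex \<Rightarrow> complex \<times> complex" where
  "ratmap_apply f x =
     (eval2 (fst (fst f)) x / eval2 (snd (fst f)) x, eval2 (fst (snd f)) x / eval2 (snd (snd f)) x)"

text \<open>
  \<open>f \<circ> g = id\<close> off \<open>V\<close> includes that the composite is defined there; since division by zero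
  yields zero, this has to be required explicitly.  Nothing depends on the fractions
  being reduced, because the vanishing loci of the denominators can be absorbed into \<open>V\<close>.
\<close>
definition inverse_off :: "(complex \<times> complex) set \<Rightarrow> ratmap2 \<Rightarrow> ratmap2 \<Rightarrow> bool" where
  "inverse_off V f g \<longleftrightarrow> (\<forall>x. x \<notin> V \<longrightarrow>
     regular_at g x \<and> regular_at f (ratmap_apply g x) \<and> ratmap_apply f (ratmap_apply g x) = x)"

definition birational :: "ratmap2 \<Rightarrow> bool" where
  "birational f \<longleftrightarrow> rational_map f \<and>
     (\<exists>V g. algebraic_curve V \<and> rational_map g \<and> inverse_off V f g \<and> inverse_off V g f)"

definition affine_poly :: "complex \<Rightarrow> complex \<Rightarrow> complex \<Rightarrow> poly2" where
  "affine_poly a0 a1 a2 = [:[:a0, a1:], [:a2:]:]"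

text \<open>The coefficient triples \<open>\<alpha>\<close>, \<open>\<beta>\<close>, \<open>\<gamma>\<close> are functions of which only the values at 0, 1, 2 are used.\<close>
definition affine_map ::
    "(nat \<Rightarrow> complex) \<Rightarrow> (nat \<Rightarrow> complex) \<Rightarrow> (nat \<Rightarrow> complex) \<Rightarrow> ratmap2" where
  "affine_map \<alpha> \<beta> \<gamma> =
     ((affine_poly (\<alpha> 0) (\<alpha> 1) (\<alpha> 2), 1),
      (affine_poly (\<beta> 0) (\<beta> 1) (\<beta> 2), affine_poly (\<gamma> 0) (\<gamma> 1) (\<gamma> 2)))"

lemma ratmap_apply_affine_map:
  "ratmap_apply (affine_map \<alpha> \<beta> \<gamma>) (x1, x2) =
     (\<alpha> 0 + \<alpha> 1 * x1 + \<alpha> 2 * x2,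
      (\<beta> 0 + \<beta> 1 * x1 + \<beta> 2 * x2) / (\<gamma> 0 + \<gamma> 1 * x1 + \<gamma> 2 * x2))"
  by (simp add: ratmap_apply_def affine_map_def affine_poly_def eval2_def algebra_simps)


section \<open>Rational self-maps of the projective plane\<close>

text \<open>\<open>\<complex>[x\<^sub>0][x\<^sub>1][x\<^sub>2]\<close>: the innermost variable is \<open>x\<^sub>0\<close>, the outermost \<open>x\<^sub>2\<close>.\<close>
type_synonym poly3 = "complex poly poly poly"

definition Const3 :: "complex \<Rightarrow> poly3" where "Const3 c = [:[:[:c:]:]:]"
definition X0 :: poly3 where "X0 = [:[:[:0, 1:]:]:]"
definition X1 :: poly3 where "X1 = [:[:0, 1:]:]"
definition X2 :: poly3 where "X2 = [:0, 1:]"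

definition total_degree :: "poly3 \<Rightarrow> nat" where
  "total_degree p = Max (insert 0 {i + j + k | i j k. coeff (coeff (coeff p k) j) i \<noteq> 0})"

text \<open>
  A triple \<open>(P\<^sub>1, P\<^sub>2, P\<^sub>3)\<close> of homogeneous polynomials of equal degree stands for the map
  \<open>[P\<^sub>1 : P\<^sub>2 : P\<^sub>3]\<close>; a common factor of the components does not change the map.
\<close>
type_synonym projmap = "poly3 \<times> poly3 \<times> poly3"

text \<open>Substitution of the components of \<open>G\<close> for \<open>x\<^sub>0, x\<^sub>1, x\<^sub>2\<close>.\<close>
definition subst3 :: "projmap \<Rightarrow> poly3 \<Rightarrow> poly3" where
  "subst3 G p = (case G of (G0, G1, G2) \<Rightarrow>
     poly (map_poly (\<lambda>q. poly (map_poly (\<lambda>r. poly (map_poly Const3 r) G0) q) G1) p) G2)"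

definition proj_comp :: "projmap \<Rightarrow> projmap \<Rightarrow> projmap" where
  "proj_comp F G = (case F of (F1, F2, F3) \<Rightarrow> (subst3 G F1, subst3 G F2, subst3 G F3))"

definition proj_iterate :: "projmap \<Rightarrow> nat \<Rightarrow> projmap" where
  "proj_iterate F n = (proj_comp F ^^ n) (X0, X1, X2)"

definition proj_reduce :: "projmap \<Rightarrow> projmap" where
  "proj_reduce F = (case F of (F1, F2, F3) \<Rightarrow>
     let h = gcd F1 (gcd F2 F3) in (F1 div h, F2 div h, F3 div h))"

text \<open>
  The nonzero components all have the same degree, so the maximum merely discards
  components that vanish identically.
\<close>
definition proj_degree :: "projmap \<Rightarrow> nat" where
  "proj_degree F = (case proj_reduce F of (F1, F2, F3) \<Rightarrow>
     max (total_degree F1) (max (total_degree F2) (total_degree F3)))"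

definition has_dynamical_degree :: "projmap \<Rightarrow> real \<Rightarrow> bool" where
  "has_dynamical_degree F \<delta> \<longleftrightarrow>
     (\<lambda>n. root n (real (proj_degree (proj_iterate F n)))) \<longlonglongrightarrow> \<delta>"

definition linear_form :: "complex \<Rightarrow> complex \<Rightarrow> complex \<Rightarrow> poly3" where
  "linear_form a0 a1 a2 = Const3 a0 * X0 + Const3 a1 * X1 + Const3 a2 * X2"

text \<open>
  The extension of \<^term>\<open>affine_map \<alpha> \<beta> \<gamma>\<close> along \<open>(x\<^sub>1, x\<^sub>2) \<mapsto> [1 : x\<^sub>1 : x\<^sub>2]\<close>, with denominators cleared.
\<close>
definition proj_extension ::
    "(nat \<Rightarrow> complex) \<Rightarrow> (nat \<Rightarrow> complex) \<Rightarrow> (nat \<Rightarrow> complex) \<Rightarrow> projmap" where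
  "proj_extension \<alpha> \<beta> \<gamma> =
     (X0 * linear_form (\<gamma> 0) (\<gamma> 1) (\<gamma> 2),
      linear_form (\<alpha> 0) (\<alpha> 1) (\<alpha> 2) * linear_form (\<gamma> 0) (\<gamma> 1) (\<gamma> 2),
      X0 * linear_form (\<beta> 0) (\<beta> 1) (\<beta> 2))"

end

theory Submission
  imports Defs "HOL-Number_Theory.Fib"
begin

text \<open>
  Since \<open>(\<beta>\<^sub>1, \<beta>\<^sub>2)\<close> is proportional to \<open>(\<gamma>\<^sub>1, \<gamma>\<^sub>2)\<close>, with ratio \<open>t\<close> say, the second component of
  \<open>f\<close> is \<open>t + c / (\<gamma>\<^sub>0 + \<gamma>\<^sub>1 x\<^sub>1 + \<gamma>\<^sub>2 x\<^sub>2)\<close>, and on homogeneous triples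
  \[ F(P, Q, R) = (P\<Gamma>,\ A\<Gamma>,\ P(t\<Gamma> + cP)), \]
  where \<open>A\<close> and \<open>\<Gamma>\<close> are the linear forms of \<open>\<alpha>\<close> and \<open>\<gamma>\<close> evaluated at \<open>(P, Q, R)\<close>.
  A birational map has dense image, which excludes \<open>c = 0\<close> (the second component would be
  constant) and \<open>\<alpha>\<^sub>1 = \<alpha>\<^sub>2 = 0\<close> (the first would be). So exactly one of \<open>\<alpha>\<^sub>1\<alpha>\<^sub>2 \<noteq> 0\<close>,
  \<open>\<alpha>\<^sub>1 = 0 \<noteq> \<alpha>\<^sub>2\<close>, \<open>\<alpha>\<^sub>1 \<noteq> 0 = \<alpha>\<^sub>2\<close> occurs.

  The degree of \<open>F\<^sup>n\<close> is found by exhibiting the reduced form of \<open>F\<^sup>n\<close>, that is, by knowing exactly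
  which factor cancels at each step. In each case a shape of the reduced triple, together with a
  few coprimality conditions, is reproduced by \<open>F\<close>:

  \<^item> If \<open>\<alpha>\<^sub>1\<alpha>\<^sub>2 \<noteq> 0\<close>, nothing ever cancels (\<open>iterate_generic\<close>). Geometrically, the two lines that \<open>F\<close>
    contracts, \<open>x\<^sub>0 = 0\<close> and \<open>\<gamma> = 0\<close>, are sent to \<open>[0:1:0]\<close> and \<open>[0:0:1]\<close>, and their orbits
    never meet the points of indeterminacy \<open>x\<^sub>0 = 0 = (\<alpha>\<^sub>1x\<^sub>1 + \<alpha>\<^sub>2x\<^sub>2)(\<gamma>\<^sub>1x\<^sub>1 + \<gamma>\<^sub>2x\<^sub>2)\<close>. The
    degree doubles at each step.
  \<^item> If \<open>\<alpha>\<^sub>1 = 0\<close>, the two affine components of \<open>F\<^sup>n\<close> for \<open>n \<ge> 1\<close> are \<open>N/U\<close> and \<open>M/V\<close> in lowest terms with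
    \<open>U\<close>, \<open>V\<close> coprime. The next denominators are \<open>V\<close> and \<open>\<Gamma>(UV, NV, MU)\<close>, of degrees \<open>deg V\<close> and
    \<open>deg U + deg V\<close>: the Fibonacci numbers appear (\<open>iterate_\<alpha>1_zero\<close>).
  \<^item> If \<open>\<alpha>\<^sub>2 = 0\<close>, the first affine component \<open>\<xi>/x\<^sub>0\<close> stays an affine function, and the denominator of the
    second gains only one degree per step (\<open>iterate_\<alpha>2_zero\<close>).

  Finally, all three degree sequences lie between \<open>r\<^sup>n\<close> and \<open>(n + 1) r\<^sup>n\<close> for the claimed \<open>r\<close>,
  which determines the limit of the \<open>n\<close>-th roots (\<open>root_tendsto_growth_rate\<close>).
\<close>

section \<open>Growth rates\<close>

lemma root_tendsto_growth_rate:
  fixes d :: "nat \<Rightarrow> nat" and r :: real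
  assumes r: "r \<ge> 0" and lower: "\<And>n. r ^ n \<le> d n" and upper: "\<And>n. d n \<le> (real n + 1) * r ^ n"
  shows "(\<lambda>n. root n (real (d n))) \<longlonglongrightarrow> r"
proof (rule tendsto_sandwich)
  show "\<forall>\<^sub>F n in sequentially. r \<le> root n (d n)"
    using eventually_gt_at_top[of 0]
  proof eventually_elim
    case (elim n)
    have "r = root n (r ^ n)" using elim r by (simp add: real_root_power_cancel)
    also have "\<dots> \<le> root n (d n)" using elim lower by simp
    finally show ?case .
  qed
  show "\<forall>\<^sub>F n in sequentially. root n (d n) \<le> root n 2 * root n n * r"
    using eventually_gt_at_top[of 0]
  proof eventually_elim
    case (elim n)
    have "d n \<le> (real n + 1) * r ^ n" by (rule upper)
    also have "\<dots> \<le> (2 * n) * r ^ n"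
      using elim r by (intro mult_right_mono) auto
    finally have "root n (d n) \<le> root n (2 * n * r ^ n)" using elim by simp
    also have "\<dots> = root n 2 * root n n * r"
      using elim r by (simp add: real_root_mult real_root_power_cancel)
    finally show ?case .
  qed
  show "(\<lambda>n. root n 2 * root n (real n) * r) \<longlonglongrightarrow> r"
    using tendsto_mult[OF tendsto_mult[OF LIMSEQ_root_const[of 2] LIMSEQ_root] tendsto_const[of r]]
    by simp
qed simp

text \<open>
  The upper bound is far from sharp; its form is the one in which all three kinds of
  degree sequence can be bounded.
\<close>
lemma fib_growth:
  fixes \<phi> :: real
  defines "\<phi> \<equiv> (1 + sqrt 5) / 2"
  shows "\<phi> ^ n \<le> fib (n + 2) \<and> fib (n + 2) \<le> (real n + 1) * \<phi> ^ n"
proof (induction n rule: fib.induct)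
  have "1 \<le> sqrt 5" by simp
  moreover have "sqrt 5 \<le> 3" by (rule real_le_lsqrt) simp_all
  ultimately have \<phi>: "1 \<le> \<phi>" "\<phi> \<le> 2" by (simp_all add: \<phi>_def)
  have rec: "\<phi> * \<phi> = \<phi> + 1" by (simp add: \<phi>_def field_simps)
  have fib2: "fib 2 = 1" and fib3: "fib 3 = 2" by (simp_all add: numeral_2_eq_2 numeral_3_eq_3)
  case 1
  show ?case using fib2 by simp
  case 2
  show ?case using fib3 \<phi> by simp
  case (3 n)
  have pow: "\<phi> ^ Suc (Suc n) = \<phi> ^ Suc n + \<phi> ^ n"
  proof -
    have "\<phi> ^ Suc (Suc n) = \<phi> ^ n * (\<phi> * \<phi>)" by simp
    also have "\<dots> = \<phi> ^ n * (\<phi> + 1)" by (simp only: rec)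
    also have "\<dots> = \<phi> ^ Suc n + \<phi> ^ n" by (simp add: algebra_simps)
    finally show ?thesis .
  qed
  have f: "real (fib (Suc (Suc n) + 2)) = real (fib (Suc n + 2)) + real (fib (n + 2))" by simp
  have "(real n + 1) * \<phi> ^ n \<le> (real n + 3) * \<phi> ^ n"
    "(real n + 2) * \<phi> ^ Suc n \<le> (real n + 3) * \<phi> ^ Suc n"
    using \<phi> by (intro mult_right_mono; simp)+
  moreover have "(real (Suc n) + 1) * \<phi> ^ Suc n = (real n + 2) * \<phi> ^ Suc n"
    "(real (Suc (Suc n)) + 1) * \<phi> ^ Suc (Suc n) = (real n + 3) * \<phi> ^ Suc n + (real n + 3) * \<phi> ^ n"
    unfolding pow by (simp_all only: of_nat_Suc distrib_left) (simp_all add: add.commute)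
  ultimately show ?case using 3 f pow by linarith
qed

section \<open>Homogeneous polynomials and the degree of a map\<close>

lemma Const3_ring:
  "Const3 (a + b) = Const3 a + Const3 b" "Const3 (a * b) = Const3 a * Const3 b"
  "Const3 0 = 0" "Const3 1 = 1"
  by (simp_all add: Const3_def one_pCons)

definition homogeneous :: "nat \<Rightarrow> poly3 \<Rightarrow> bool" where
  "homogeneous d p \<longleftrightarrow> (\<forall>i j k. coeff (coeff (coeff p k) j) i \<noteq> 0 \<longrightarrow> i + j + k = d)"

lemma homogeneous_add: "homogeneous d p \<Longrightarrow> homogeneous d q \<Longrightarrow> homogeneous d (p + q)"
  by (auto simp: homogeneous_def) (metis add.right_neutral)

lemma homogeneous_mult:
  assumes "homogeneous d p" "homogeneous e q"
  shows "homogeneous (d + e) (p * q)"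
  unfolding homogeneous_def
proof (intro allI impI)
  fix i j k assume "coeff (coeff (coeff (p * q) k) j) i \<noteq> 0"
  then obtain a where a: "a \<le> k" "coeff (coeff (coeff p a * coeff q (k - a)) j) i \<noteq> 0"
    unfolding coeff_mult[of p] coeff_sum by (blast elim: sum.not_neutral_contains_not_neutral)
  then obtain b where b: "b \<le> j" "coeff (coeff (coeff p a) b * coeff (coeff q (k - a)) (j - b)) i \<noteq> 0"
    unfolding coeff_mult[of "coeff p a"] coeff_sum by (blast elim: sum.not_neutral_contains_not_neutral)
  then obtain c where c: "c \<le> i"
    "coeff (coeff (coeff p a) b) c * coeff (coeff (coeff q (k - a)) (j - b)) (i - c) \<noteq> 0"
    unfolding coeff_mult by (blast elim: sum.not_neutral_contains_not_neutral)
  then have "coeff (coeff (coeff p a) b) c \<noteq> 0" "coeff (coeff (coeff q (k - a)) (j - b)) (i - c) \<noteq> 0"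
    by auto
  then have "c + b + a = d" "(i - c) + (j - b) + (k - a) = e"
    using assms unfolding homogeneous_def by blast+
  with a b c show "i + j + k = d + e" by linarith
qed

lemma homogeneous_Const3: "homogeneous 0 (Const3 c)"
  by (auto simp: homogeneous_def Const3_def coeff_pCons split: nat.splits)

lemma homogeneous_Const3_mult: "homogeneous d p \<Longrightarrow> homogeneous d (Const3 c * p)"
  using homogeneous_mult[OF homogeneous_Const3] by fastforce

lemma homogeneous_X: "homogeneous 1 X0" "homogeneous 1 X1" "homogeneous 1 X2"
  by (auto simp: homogeneous_def X0_def X1_def X2_def coeff_pCons one_pCons split: nat.splits)

lemma total_degree_homogeneous:
  assumes "homogeneous d p" shows "total_degree p = (if p = 0 then 0 else d)"
proof (cases "p = 0")
  case True then show ?thesis by (simp add: total_degree_def)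
next
  case False
  then obtain k j i where "coeff (coeff (coeff p k) j) i \<noteq> 0"
    by (metis leading_coeff_0_iff)
  then have "{i + j + k | i j k. coeff (coeff (coeff p k) j) i \<noteq> 0} = {d}"
    using assms by (force simp: homogeneous_def)
  then show ?thesis using False by (simp add: total_degree_def)
qed

lemma is_unit_poly3E:
  assumes "is_unit (u :: poly3)" obtains c where "c \<noteq> 0" "u = Const3 c"
  using assms unfolding is_unit_poly_iff Const3_def
  by (metis is_unit_poly_iff not_is_unit_0)

lemma is_unit_Const3: "c \<noteq> 0 \<Longrightarrow> is_unit (Const3 c)"
  by (simp add: Const3_def is_unit_const_poly_iff dvd_field_iff)

lemma not_is_unit_homogeneous:
  assumes "homogeneous d p" "d > 0" shows "\<not> is_unit p"
proof
  assume "is_unit p"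
  then obtain c where "c \<noteq> 0" "p = Const3 c" by (rule is_unit_poly3E)
  moreover have "total_degree p = 0"
    using total_degree_homogeneous[OF homogeneous_Const3] calculation by simp
  ultimately show False using assms total_degree_homogeneous[OF assms(1)] by (simp add: Const3_def)
qed

text \<open>
  The \<open>gcd\<close> of the components is a normalized associate of \<open>h\<close>, so dividing by it may leave a
  constant factor; constants do not affect degrees. The triple may contain zeros, but coprimality
  excludes that all three components vanish.
\<close>
lemma proj_degree_eq:
  assumes hom: "homogeneous d P" "homogeneous d Q" "homogeneous d R"
    and reduced: "\<And>p. p dvd P \<Longrightarrow> p dvd Q \<Longrightarrow> p dvd R \<Longrightarrow> is_unit p"
    and "h \<noteq> 0"
  shows "proj_degree (h * P, h * Q, h * R) = d"
proof -
  have "is_unit (gcd P (gcd Q R))" by (rule reduced) (auto intro: dvd_trans)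
  then have "gcd P (gcd Q R) = 1" by simp
  then have g: "gcd (h * P) (gcd (h * Q) (h * R)) = normalize h"
    by (simp add: gcd_mult_left)
  obtain u where u: "is_unit u" "h = u * normalize h"
    by (metis unit_factor_mult_normalize unit_factor_is_unit \<open>h \<noteq> 0\<close>)
  obtain c where c: "u = Const3 c" using u by (auto elim: is_unit_poly3E)
  have div_normalize: "h * S div normalize h = u * S" for S
  proof -
    have "h * S = (u * S) * normalize h" by (subst u(2)) (simp only: mult_ac)
    also have "\<dots> div normalize h = u * S"
      using \<open>h \<noteq> 0\<close> by (intro nonzero_mult_div_cancel_right) simp
    finally show ?thesis .
  qed
  have "homogeneous d (u * S)" if "homogeneous d S" for S
    using homogeneous_mult[OF homogeneous_Const3 that] c by simp
  moreover have "u \<noteq> 0" using u by auto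
  moreover have "P \<noteq> 0 \<or> Q \<noteq> 0 \<or> R \<noteq> 0" using reduced[of 0] by auto
  ultimately have "max (total_degree (u * P)) (max (total_degree (u * Q)) (total_degree (u * R))) = d"
    using hom by (auto simp: total_degree_homogeneous[of d])
  then show ?thesis using div_normalize by (simp add: proj_degree_def proj_reduce_def g)
qed

section \<open>Coprimality\<close>

lemma prime_elem_X0: "prime_elem X0"
  unfolding X0_def prime_elem_const_poly_iff
  by (rule prime_elem_linear_field_poly) simp

lemma X0_dvd_linear_form_iff: "X0 dvd linear_form a0 a1 a2 \<longleftrightarrow> a1 = 0 \<and> a2 = 0"
proof
  assume "X0 dvd linear_form a0 a1 a2"
  then have *: "\<And>j k. [:0, 1:] dvd coeff (coeff (linear_form a0 a1 a2) k) j"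
    by (simp add: X0_def const_poly_dvd_iff)
  have "[:0, 1:] dvd [:a1:]" "[:0,1:] dvd [:a2:]"
    using *[of 0 1] *[of 1 0] by (simp_all add: linear_form_def Const3_def X0_def X1_def X2_def)
  then show "a1 = 0 \<and> a2 = 0" by (simp add: dvd_iff_poly_eq_0)
next
  assume "a1 = 0 \<and> a2 = 0" then show "X0 dvd linear_form a0 a1 a2"
    by (simp add: linear_form_def Const3_ring)
qed

lemma coprime_X0_linear_form: "a1 \<noteq> 0 \<or> a2 \<noteq> 0 \<Longrightarrow> coprime X0 (linear_form a0 a1 a2)"
  using prime_elem_imp_coprime[OF prime_elem_X0] X0_dvd_linear_form_iff by blast

lemma coprime_add_multiple_iff:
  fixes a :: poly3 shows "coprime a (a * k + b) \<longleftrightarrow> coprime a b"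
  using gcd_add_mult[of a k b] by (simp add: coprime_iff_gcd_eq_1 mult.commute)

lemma coprime_Const3:
  assumes "c \<noteq> 0" shows "coprime a (Const3 c)" "coprime (Const3 c) a"
  using is_unit_Const3[OF assms] by (auto intro: is_unit_right_imp_coprime is_unit_left_imp_coprime)

lemma dvd_of_dvd_coprime_multiples:
  fixes a :: poly3
  assumes "coprime a b" "p dvd a * c" "p dvd b * c" shows "p dvd c"
proof -
  have "p dvd gcd (a * c) (b * c)" using assms by simp
  then show ?thesis using assms(1) by (simp add: gcd_mult_right gcd.commute coprime_iff_gcd_eq_1)
qed

section \<open>Consequences of birationality\<close>

lemma eval2_mult: "eval2 (p * q) x = eval2 p x * eval2 q x"
  by (simp add: eval2_def)

lemma eval2_nonzero:
  assumes "p \<noteq> 0" obtains x where "eval2 p x \<noteq> 0"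
proof -
  have "finite {q. poly p q = 0}" using assms by (rule poly_roots_finite)
  moreover have "infinite (range (\<lambda>c :: complex. [:c:]))"
    by (simp add: finite_image_iff inj_def infinite_UNIV_char_0)
  ultimately obtain b where "poly p [:b:] \<noteq> 0"
    by (metis (mono_tags, lifting) finite_subset image_subsetI mem_Collect_eq)
  moreover from this obtain a where "poly (poly p [:b:]) a \<noteq> 0"
    using poly_all_0_iff_0 by blast
  ultimately show ?thesis using that[of "(a, b)"] by (simp add: eval2_def)
qed

text \<open>
  The right inverse is defined off a curve, and the union of that curve with the zero set of \<open>q\<close> is
  again a curve, hence not the whole plane. In particular no component of \<open>f\<close> is constant.
\<close>
lemma birational_dominant:
  assumes "birational f" "q \<noteq> 0"
  obtains y where "regular_at f y" "eval2 q (ratmap_apply f y) \<noteq> 0"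
proof -
  obtain V g where V: "algebraic_curve V" "inverse_off V f g"
    using assms(1) unfolding birational_def by auto
  then obtain p where p: "p \<noteq> 0" "V = {x. eval2 p x = 0}"
    unfolding algebraic_curve_def by (metis pCons_0_0)
  then obtain x where "eval2 (p * q) x \<noteq> 0"
    using assms(2) by (metis eval2_nonzero mult_eq_0_iff)
  then have "x \<notin> V" "eval2 q x \<noteq> 0" using p by (simp_all add: eval2_mult)
  then show ?thesis using V(2) that unfolding inverse_off_def by metis
qed

lemma birational_first_component_nonconstant:
  assumes "birational (affine_map \<alpha> \<beta> \<gamma>)"
  shows "\<alpha> 1 \<noteq> 0 \<or> \<alpha> 2 \<noteq> 0"
proof -
  have "[:[:- \<alpha> 0, 1:]:] \<noteq> 0" by simp
  from birational_dominant[OF assms this]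
  obtain y where y: "eval2 [:[:- \<alpha> 0, 1:]:] (ratmap_apply (affine_map \<alpha> \<beta> \<gamma>) y) \<noteq> 0" .
  obtain y1 y2 where "y = (y1, y2)" by (cases y)
  with y have "\<alpha> 1 * y1 + \<alpha> 2 * y2 \<noteq> 0"
    by (simp add: ratmap_apply_affine_map eval2_def)
  then show ?thesis by auto
qed

lemma birational_second_component_nonconstant:
  assumes "birational (affine_map \<alpha> \<beta> \<gamma>)"
  shows "\<not> (\<beta> 0 = t * \<gamma> 0 \<and> \<beta> 1 = t * \<gamma> 1 \<and> \<beta> 2 = t * \<gamma> 2)"
proof
  assume \<beta>: "\<beta> 0 = t * \<gamma> 0 \<and> \<beta> 1 = t * \<gamma> 1 \<and> \<beta> 2 = t * \<gamma> 2"
  have "[:[:- t:], 1:] \<noteq> 0" by simp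
  from birational_dominant[OF assms this]
  obtain y where y: "regular_at (affine_map \<alpha> \<beta> \<gamma>) y"
    "eval2 [:[:- t:], 1:] (ratmap_apply (affine_map \<alpha> \<beta> \<gamma>) y) \<noteq> 0" .
  obtain y1 y2 where y12: "y = (y1, y2)" by (cases y)
  have "\<gamma> 0 + \<gamma> 1 * y1 + \<gamma> 2 * y2 \<noteq> 0"
    using y(1) unfolding y12
    by (simp add: regular_at_def affine_map_def affine_poly_def eval2_def algebra_simps)
  moreover have "\<beta> 0 + \<beta> 1 * y1 + \<beta> 2 * y2 = t * (\<gamma> 0 + \<gamma> 1 * y1 + \<gamma> 2 * y2)"
    unfolding \<beta>[THEN conjunct1] \<beta>[THEN conjunct2, THEN conjunct1] \<beta>[THEN conjunct2, THEN conjunct2]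
    by (simp add: algebra_simps)
  ultimately show False using y(2) unfolding y12 ratmap_apply_affine_map by (simp add: eval2_def)
qed

section \<open>The iterates of the map\<close>

lemma proj_comp_extension:
  "proj_comp (proj_extension \<alpha> \<beta> \<gamma>) (P, Q, R) =
     (let A = Const3 (\<alpha> 0) * P + Const3 (\<alpha> 1) * Q + Const3 (\<alpha> 2) * R;
          B = Const3 (\<beta> 0) * P + Const3 (\<beta> 1) * Q + Const3 (\<beta> 2) * R;
          C = Const3 (\<gamma> 0) * P + Const3 (\<gamma> 1) * Q + Const3 (\<gamma> 2) * R
      in (P * C, A * C, P * B))"
proof -
  have literal: "linear_form a b c = [:[:[:0, a:], [:b:]:], [:[:c:]:]:]" for a b c
    by (simp add: linear_form_def Const3_def X0_def X1_def X2_def)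
  show ?thesis
    by (simp add: proj_comp_def proj_extension_def subst3_def literal X0_def map_poly_pCons
        Const3_ring Let_def algebra_simps)
qed

lemma proj_iterate_Suc: "proj_iterate F (Suc n) = proj_comp F (proj_iterate F n)"
  by (simp add: proj_iterate_def)

lemma proj_iterate_0: "proj_iterate F 0 = (X0, X1, X2)"
  by (simp add: proj_iterate_def)

text \<open>The situation in which the second component of \<open>f\<close> is \<open>t + c / (\<gamma>\<^sub>0 + \<gamma>\<^sub>1 x\<^sub>1 + \<gamma>\<^sub>2 x\<^sub>2)\<close>.\<close>
locale parallel_fraction =
  fixes \<alpha> \<beta> \<gamma> :: "nat \<Rightarrow> complex" and t c :: complex
  assumes \<gamma>: "\<gamma> 1 \<noteq> 0" "\<gamma> 2 \<noteq> 0"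
    and \<beta>: "\<beta> 0 = t * \<gamma> 0 + c" "\<beta> 1 = t * \<gamma> 1" "\<beta> 2 = t * \<gamma> 2"
    and c: "c \<noteq> 0"
begin

abbreviation "\<Phi> \<equiv> proj_extension \<alpha> \<beta> \<gamma>"

definition A :: "poly3 \<Rightarrow> poly3 \<Rightarrow> poly3 \<Rightarrow> poly3" where
  "A P Q R = Const3 (\<alpha> 0) * P + (Const3 (\<alpha> 1) * Q + Const3 (\<alpha> 2) * R)"

definition \<Gamma> :: "poly3 \<Rightarrow> poly3 \<Rightarrow> poly3 \<Rightarrow> poly3" where
  "\<Gamma> P Q R = Const3 (\<gamma> 0) * P + (Const3 (\<gamma> 1) * Q + Const3 (\<gamma> 2) * R)"

lemma proj_comp_\<Phi>:
  "proj_comp \<Phi> (P, Q, R) =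
     (P * \<Gamma> P Q R, A P Q R * \<Gamma> P Q R, P * (Const3 t * \<Gamma> P Q R + Const3 c * P))"
  unfolding proj_comp_extension A_def \<Gamma>_def by (simp add: \<beta>[simplified] Const3_ring algebra_simps)

lemma homogeneous_A_\<Gamma>:
  assumes "homogeneous d P" "homogeneous d Q" "homogeneous d R"
  shows "homogeneous d (A P Q R)" "homogeneous d (\<Gamma> P Q R)"
  unfolding A_def \<Gamma>_def using assms by (auto intro!: homogeneous_add homogeneous_Const3_mult)

lemma homogeneous_third:
  assumes "homogeneous d P" "homogeneous d Q"
  shows "homogeneous d (Const3 t * P + Const3 c * Q)"
  using assms by (auto intro!: homogeneous_add homogeneous_Const3_mult)

text \<open>
  The invariant says that no component of the curve \<open>P = 0\<close>, which \<open>F\<^sup>n\<close> sends into the line at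
  infinity, is mapped to a point of indeterminacy of \<open>F\<close>. It persists because modulo a factor of
  the new first component \<open>P\<Gamma>\<close> one of the other two components vanishes and the other does not: modulo
  \<open>P\<close> the third is zero and the second is \<open>A\<Gamma>\<close>, congruent to the product of the two forms
  in the invariant; modulo \<open>\<Gamma>\<close> the second is zero and the third is \<open>cP\<^sup>2\<close>. A combination \<open>aQ + bR\<close>
  with \<open>ab \<noteq> 0\<close> is then coprime to \<open>P\<Gamma>\<close>.
\<close>
lemma iterate_generic:
  assumes "\<alpha> 1 \<noteq> 0" "\<alpha> 2 \<noteq> 0"
  shows "\<exists>P Q R. proj_iterate \<Phi> n = (P, Q, R) \<and>
    homogeneous (2 ^ n) P \<and> homogeneous (2 ^ n) Q \<and> homogeneous (2 ^ n) R \<and>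
    coprime P (Const3 (\<alpha> 1) * Q + Const3 (\<alpha> 2) * R) \<and>
    coprime P (Const3 (\<gamma> 1) * Q + Const3 (\<gamma> 2) * R)"
proof (induction n)
  case 0
  have "coprime X0 (Const3 a * X1 + Const3 b * X2)" if "a \<noteq> 0" for a b
    using coprime_X0_linear_form[of a b 0] that by (simp add: linear_form_def Const3_ring)
  then show ?case using homogeneous_X assms \<gamma> by (simp add: proj_iterate_0)
next
  case (Suc n)
  then obtain P Q R where it: "proj_iterate \<Phi> n = (P, Q, R)"
    and hom: "homogeneous (2 ^ n) P" "homogeneous (2 ^ n) Q" "homogeneous (2 ^ n) R"
    and cop: "coprime P (Const3 (\<alpha> 1) * Q + Const3 (\<alpha> 2) * R)"
      "coprime P (Const3 (\<gamma> 1) * Q + Const3 (\<gamma> 2) * R)" by blast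
  define W B T where "W = \<Gamma> P Q R" and "B = A P Q R" and "T = Const3 t * W + Const3 c * P"
  have PW: "coprime P W" and PB: "coprime P B"
    using cop unfolding W_def B_def A_def \<Gamma>_def
    by (simp_all add: coprime_add_multiple_iff mult.commute[of _ P])
  have next_coprime: "coprime (P * W) (Const3 a * (B * W) + Const3 b * (P * T))"
    if ab: "a \<noteq> 0" "b \<noteq> 0" for a b
  proof -
    have "coprime P (Const3 a * (B * W) + Const3 b * (P * T)) \<longleftrightarrow>
        coprime P (P * (Const3 b * T) + Const3 a * (B * W))"
      by (simp add: algebra_simps)
    also have "\<dots>" unfolding coprime_add_multiple_iff using ab PW PB by (simp add: coprime_Const3)
    finally have 1: "coprime P (Const3 a * (B * W) + Const3 b * (P * T))" .
    have "coprime W (Const3 a * (B * W) + Const3 b * (P * T)) \<longleftrightarrow>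
        coprime W (W * (Const3 a * B + Const3 b * P * Const3 t) + Const3 b * Const3 c * (P * P))"
      unfolding T_def by (simp add: algebra_simps)
    also have "\<dots>" unfolding coprime_add_multiple_iff
      using ab PW c by (simp add: coprime_Const3 coprime_commute[of W P])
    finally show ?thesis using 1 by simp
  qed
  have "homogeneous (2 ^ n) W" "homogeneous (2 ^ n) B" "homogeneous (2 ^ n) T"
    unfolding W_def B_def T_def by (intro homogeneous_A_\<Gamma> homogeneous_third hom)+
  then have "homogeneous (2 ^ Suc n) (P * W)" "homogeneous (2 ^ Suc n) (B * W)"
    "homogeneous (2 ^ Suc n) (P * T)"
    using homogeneous_mult hom(1) by (metis mult_2 power_Suc)+
  moreover have "proj_iterate \<Phi> (Suc n) = (P * W, B * W, P * T)"
    unfolding proj_iterate_Suc it proj_comp_\<Phi> W_def B_def T_def ..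
  ultimately show ?case using next_coprime assms \<gamma> by blast
qed

lemma degree_generic:
  assumes "\<alpha> 1 \<noteq> 0" "\<alpha> 2 \<noteq> 0"
  shows "proj_degree (proj_iterate \<Phi> n) = 2 ^ n"
proof -
  obtain P Q R where it: "proj_iterate \<Phi> n = (P, Q, R)"
    and hom: "homogeneous (2 ^ n) P" "homogeneous (2 ^ n) Q" "homogeneous (2 ^ n) R"
    and cop: "coprime P (Const3 (\<alpha> 1) * Q + Const3 (\<alpha> 2) * R)"
    using iterate_generic[OF assms] by blast
  have "proj_degree (1 * P, 1 * Q, 1 * R) = 2 ^ n"
  proof (rule proj_degree_eq[OF hom])
    fix p assume "p dvd P" "p dvd Q" "p dvd R"
    then show "is_unit p" by (intro coprime_common_divisor[OF cop]) auto
  qed simp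
  then show ?thesis by (simp add: it)
qed

text \<open>
  Here \<open>F(UV, NV, MU) = U \<cdot> (VW, N'W, M'V)\<close> with \<open>W = \<Gamma>(UV, NV, MU)\<close>, so exactly the factor \<open>U\<close>
  cancels and the new denominators are \<open>V\<close> and \<open>W\<close>. Modulo \<open>V\<close> and modulo \<open>U\<close>, the form \<open>W\<close>
  reduces to \<open>\<gamma>\<^sub>2MU\<close> and \<open>\<gamma>\<^sub>1NV\<close>, so the three coprimality conditions make \<open>W\<close> coprime to both, and
  with \<open>N' = \<alpha>\<^sub>0V + \<alpha>\<^sub>2M\<close> and \<open>M' = tW + cUV\<close> they reproduce themselves. The
  shape starts at the first iterate: for the identity both components have denominator \<open>x\<^sub>0\<close>.
\<close>
lemma iterate_\<alpha>1_zero: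
  assumes "\<alpha> 1 = 0" "\<alpha> 2 \<noteq> 0"
  shows "\<exists>h U V N M. proj_iterate \<Phi> (Suc n) = (h * (U * V), h * (N * V), h * (M * U)) \<and> h \<noteq> 0 \<and>
    homogeneous (fib (n + 1)) U \<and> homogeneous (fib (n + 2)) V \<and>
    homogeneous (fib (n + 1)) N \<and> homogeneous (fib (n + 2)) M \<and>
    coprime U V \<and> coprime U N \<and> coprime V M"
proof (induction n)
  case 0
  let ?V = "\<Gamma> X0 X1 X2" and ?N = "A X0 X1 X2"
  let ?M = "Const3 t * ?V + Const3 c * X0"
  have XV: "coprime X0 ?V" and XN: "coprime X0 ?N"
    using coprime_X0_linear_form \<gamma> assms unfolding \<Gamma>_def A_def linear_form_def by (metis add.assoc)+
  have "coprime ?V (?V * Const3 t + Const3 c * X0)"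
    unfolding coprime_add_multiple_iff using c XV by (simp add: coprime_Const3 coprime_commute)
  then have VM: "coprime ?V ?M" by (simp add: mult.commute)
  have hom: "homogeneous 1 ?V" "homogeneous 1 ?N" "homogeneous 1 ?M"
    by (intro homogeneous_A_\<Gamma> homogeneous_third homogeneous_X)+
  have "proj_iterate \<Phi> (Suc 0) = (1 * (X0 * ?V), 1 * (?N * ?V), 1 * (?M * X0))"
    unfolding proj_iterate_Suc proj_iterate_0 proj_comp_\<Phi> by (simp add: mult.commute)
  then show ?case using XV XN VM hom homogeneous_X(1)
    by (intro exI[of _ 1] exI[of _ X0] exI[of _ ?V] exI[of _ ?N] exI[of _ ?M]) (simp add: numeral_2_eq_2)
next
  case (Suc n)
  then obtain h U V N M
    where it: "proj_iterate \<Phi> (Suc n) = (h * (U * V), h * (N * V), h * (M * U))" and h: "h \<noteq> 0"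
    and hom: "homogeneous (fib (n + 1)) U" "homogeneous (fib (n + 2)) V"
      "homogeneous (fib (n + 1)) N" "homogeneous (fib (n + 2)) M"
    and cop: "coprime U V" "coprime U N" "coprime V M" by blast
  let ?N = "Const3 (\<alpha> 0) * V + Const3 (\<alpha> 2) * M" and ?W = "\<Gamma> (U * V) (N * V) (M * U)"
  let ?M = "Const3 t * ?W + Const3 c * (U * V)"
  have "proj_iterate \<Phi> (Suc (Suc n)) =
      ((h * h * U) * (V * ?W), (h * h * U) * (?N * ?W), (h * h * U) * (?M * V))"
    unfolding proj_iterate_Suc[of \<Phi> "Suc n"] it proj_comp_\<Phi> A_def \<Gamma>_def using assms
    by (simp add: Const3_ring algebra_simps)
  \<comment> \<open>Otherwise \<open>V\<close>, being coprime to \<open>0\<close>, would be a unit despite its positive degree.\<close>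
  moreover have "U \<noteq> 0"
    using not_is_unit_homogeneous[OF hom(2)] cop(1) fib_neq_0_nat[of "n + 2"] by auto
  moreover have "coprime V ?W"
  proof -
    have "?W = V * (Const3 (\<gamma> 0) * U + Const3 (\<gamma> 1) * N) + Const3 (\<gamma> 2) * (M * U)"
      by (simp add: \<Gamma>_def algebra_simps)
    also have "coprime V \<dots>" unfolding coprime_add_multiple_iff
      using cop \<gamma> by (simp add: coprime_Const3 coprime_commute)
    finally show ?thesis .
  qed
  moreover have "coprime U ?W"
  proof -
    have "?W = U * (Const3 (\<gamma> 0) * V + Const3 (\<gamma> 2) * M) + Const3 (\<gamma> 1) * (N * V)"
      by (simp add: \<Gamma>_def algebra_simps)
    also have "coprime U \<dots>" unfolding coprime_add_multiple_iff
      using cop \<gamma> by (simp add: coprime_Const3)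
    finally show ?thesis .
  qed
  moreover have "coprime V ?N"
    using cop(3) assms(2) coprime_add_multiple_iff[of V "Const3 (\<alpha> 0)" "Const3 (\<alpha> 2) * M"]
    by (simp add: coprime_Const3 mult.commute)
  moreover have "coprime ?W ?M"
  proof -
    have "coprime ?W (?W * Const3 t + Const3 c * (U * V))" unfolding coprime_add_multiple_iff
      using \<open>coprime V ?W\<close> \<open>coprime U ?W\<close> c by (simp add: coprime_Const3 coprime_commute)
    then show ?thesis by (simp add: mult.commute)
  qed
  moreover have "homogeneous (fib (n + 2)) ?N"
    by (intro homogeneous_add homogeneous_Const3_mult hom)
  moreover have fib: "fib (n + 3) = fib (n + 1) + fib (n + 2)"
    by (simp add: numeral_3_eq_3 numeral_2_eq_2)
  have "homogeneous (fib (n + 3)) (U * V)" "homogeneous (fib (n + 3)) (N * V)"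
    "homogeneous (fib (n + 3)) (M * U)"
    unfolding fib using homogeneous_mult hom by (metis add.commute)+
  then have "homogeneous (fib (n + 3)) ?W" by (intro homogeneous_A_\<Gamma>)
  moreover from this have "homogeneous (fib (n + 3)) ?M"
    using \<open>homogeneous (fib (n + 3)) (U * V)\<close> by (rule homogeneous_third)
  ultimately show ?case using h hom(2)
    by (intro exI[of _ "h * h * U"] exI[of _ V] exI[of _ ?W] exI[of _ ?N] exI[of _ ?M])
      (simp add: numeral_3_eq_3 numeral_2_eq_2)
qed

lemma degree_\<alpha>1_zero:
  assumes "\<alpha> 1 = 0" "\<alpha> 2 \<noteq> 0"
  shows "proj_degree (proj_iterate \<Phi> n) = fib (n + 2)"
proof (cases n)
  case 0
  have "coprime X0 (linear_form 0 1 0)" by (rule coprime_X0_linear_form) simp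
  then have "coprime X0 X1" by (simp add: linear_form_def Const3_ring)
  then have "proj_degree (1 * X0, 1 * X1, 1 * X2) = 1"
    using homogeneous_X by (intro proj_degree_eq) (auto intro: coprime_common_divisor)
  then show ?thesis by (simp add: 0 proj_iterate_0 numeral_2_eq_2)
next
  case (Suc m)
  obtain h U V N M
    where it: "proj_iterate \<Phi> (Suc m) = (h * (U * V), h * (N * V), h * (M * U))" and h: "h \<noteq> 0"
    and hom: "homogeneous (fib (m + 1)) U" "homogeneous (fib (m + 2)) V"
      "homogeneous (fib (m + 1)) N" "homogeneous (fib (m + 2)) M"
    and cop: "coprime U V" "coprime U N" "coprime V M"
    using iterate_\<alpha>1_zero[OF assms] by blast
  have fib: "fib (n + 2) = fib (m + 1) + fib (m + 2)"
    by (simp add: Suc numeral_2_eq_2)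
  show ?thesis unfolding Suc[symmetric] it[folded Suc]
  proof (rule proj_degree_eq)
    show "homogeneous (fib (n + 2)) (U * V)" "homogeneous (fib (n + 2)) (N * V)"
      "homogeneous (fib (n + 2)) (M * U)"
      unfolding fib using homogeneous_mult hom by (metis add.commute)+
    fix p assume p: "p dvd U * V" "p dvd N * V" "p dvd M * U"
    have "p dvd V" using dvd_of_dvd_coprime_multiples[OF cop(2) p(1,2)] .
    moreover have "coprime V (M * U)" using cop by (simp add: coprime_commute)
    ultimately show "is_unit p" using p(3) coprime_common_divisor by blast
  qed (rule h)
qed

text \<open>
  Here \<open>F(x\<^sub>0U, \<xi>U, Y) = U \<cdot> (x\<^sub>0W, \<xi>'W, Y')\<close> with \<open>W = \<Gamma>(x\<^sub>0U, \<xi>U, Y)\<close>, so again the factor \<open>U\<close>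
  cancels. Coprimality of \<open>W\<close> with \<open>Y' = x\<^sub>0(tW + cx\<^sub>0U)\<close> needs \<open>W\<close> to be coprime to \<open>x\<^sub>0\<close>, which is
  why this is carried along; it persists because \<open>x\<^sub>0\<close> divides \<open>Y'\<close>, leaving \<open>\<gamma>\<^sub>1\<xi>'W\<close> modulo \<open>x\<^sub>0\<close>.
\<close>
lemma iterate_\<alpha>2_zero:
  assumes "\<alpha> 1 \<noteq> 0" "\<alpha> 2 = 0"
  shows "\<exists>h \<xi> U Y. proj_iterate \<Phi> n = (h * (X0 * U), h * (\<xi> * U), h * Y) \<and> h \<noteq> 0 \<and>
    homogeneous 1 \<xi> \<and> homogeneous n U \<and> homogeneous (n + 1) Y \<and>
    coprime X0 \<xi> \<and> coprime U Y \<and> coprime X0 (\<Gamma> (X0 * U) (\<xi> * U) Y)"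
proof (induction n)
  case 0
  have "coprime X0 (linear_form 0 1 0)" "coprime X0 (linear_form (\<gamma> 0) (\<gamma> 1) (\<gamma> 2))"
    using \<gamma> by (intro coprime_X0_linear_form; simp)+
  then have "coprime X0 X1" "coprime X0 (\<Gamma> X0 X1 X2)"
    by (simp_all add: linear_form_def Const3_ring \<Gamma>_def add.assoc)
  moreover have "homogeneous 0 1" using homogeneous_Const3[of 1] by (simp add: Const3_ring)
  ultimately show ?case using homogeneous_X
    by (intro exI[of _ 1] exI[of _ X1] exI[of _ X2]) (simp add: proj_iterate_0)
next
  case (Suc n)
  then obtain h \<xi> U Y
    where it: "proj_iterate \<Phi> n = (h * (X0 * U), h * (\<xi> * U), h * Y)" and h: "h \<noteq> 0"
    and hom: "homogeneous 1 \<xi>" "homogeneous n U" "homogeneous (n + 1) Y"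
    and cop: "coprime X0 \<xi>" "coprime U Y" "coprime X0 (\<Gamma> (X0 * U) (\<xi> * U) Y)" by blast
  let ?W = "\<Gamma> (X0 * U) (\<xi> * U) Y" and ?\<xi> = "Const3 (\<alpha> 0) * X0 + Const3 (\<alpha> 1) * \<xi>"
  let ?Y = "X0 * (Const3 t * ?W + Const3 c * (X0 * U))"
  have "proj_iterate \<Phi> (Suc n) =
      ((h * h * U) * (X0 * ?W), (h * h * U) * (?\<xi> * ?W), (h * h * U) * ?Y)"
    unfolding proj_iterate_Suc it proj_comp_\<Phi> A_def \<Gamma>_def using assms
    by (simp add: Const3_ring algebra_simps)
  \<comment> \<open>Otherwise \<open>Y\<close>, being coprime to \<open>0\<close>, would be a unit despite its positive degree.\<close>
  moreover have "U \<noteq> 0" using not_is_unit_homogeneous[OF hom(3)] cop(2) by auto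
  moreover have X\<xi>: "coprime X0 ?\<xi>"
    using cop(1) assms(1) coprime_add_multiple_iff[of X0 "Const3 (\<alpha> 0)" "Const3 (\<alpha> 1) * \<xi>"]
    by (simp add: coprime_Const3 mult.commute)
  moreover have "coprime ?W ?Y"
  proof -
    have "?W = U * (Const3 (\<gamma> 0) * X0 + Const3 (\<gamma> 1) * \<xi>) + Const3 (\<gamma> 2) * Y"
      by (simp add: \<Gamma>_def algebra_simps)
    also have "coprime U \<dots>" unfolding coprime_add_multiple_iff
      using cop \<gamma> by (simp add: coprime_Const3)
    finally have "coprime ?W (?W * Const3 t + Const3 c * (X0 * U))"
      unfolding coprime_add_multiple_iff using cop(3) c by (simp add: coprime_Const3 coprime_commute)
    then show ?thesis using cop(3) by (simp add: mult.commute coprime_commute)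
  qed
  moreover have "coprime X0 (\<Gamma> (X0 * ?W) (?\<xi> * ?W) ?Y)"
  proof -
    have "\<Gamma> (X0 * ?W) (?\<xi> * ?W) ?Y =
        X0 * (Const3 (\<gamma> 0) * ?W + Const3 (\<gamma> 2) * (Const3 t * ?W + Const3 c * (X0 * U)))
        + Const3 (\<gamma> 1) * (?\<xi> * ?W)"
      unfolding \<Gamma>_def[of "X0 * ?W"] by (simp only: algebra_simps)
    also have "coprime X0 \<dots>" unfolding coprime_add_multiple_iff
      using cop(3) X\<xi> \<gamma> by (simp add: coprime_Const3)
    finally show ?thesis .
  qed
  moreover have "homogeneous 1 ?\<xi>"
    by (intro homogeneous_add homogeneous_Const3_mult hom homogeneous_X)
  moreover have XU: "homogeneous (n + 1) (X0 * U)" "homogeneous (n + 1) (\<xi> * U)"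
    using homogeneous_mult[OF homogeneous_X(1) hom(2)] homogeneous_mult[OF hom(1,2)] by simp_all
  have "homogeneous (n + 1) ?W" by (intro homogeneous_A_\<Gamma> XU hom)
  moreover from homogeneous_mult[OF homogeneous_X(1) homogeneous_third[OF this XU(1)]]
  have "homogeneous (Suc n + 1) ?Y" by simp
  ultimately show ?case using h
    by (intro exI[of _ "h * h * U"] exI[of _ ?\<xi>] exI[of _ ?W] exI[of _ ?Y]) simp
qed

lemma degree_\<alpha>2_zero:
  assumes "\<alpha> 1 \<noteq> 0" "\<alpha> 2 = 0"
  shows "proj_degree (proj_iterate \<Phi> n) = n + 1"
proof -
  obtain h \<xi> U Y
    where it: "proj_iterate \<Phi> n = (h * (X0 * U), h * (\<xi> * U), h * Y)" and h: "h \<noteq> 0"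
    and hom: "homogeneous 1 \<xi>" "homogeneous n U" "homogeneous (n + 1) Y"
    and cop: "coprime X0 \<xi>" "coprime U Y"
    using iterate_\<alpha>2_zero[OF assms] by blast
  show ?thesis unfolding it
  proof (rule proj_degree_eq)
    show "homogeneous (n + 1) (X0 * U)" "homogeneous (n + 1) (\<xi> * U)"
      using homogeneous_mult[OF homogeneous_X(1) hom(2)] homogeneous_mult[OF hom(1,2)] by simp_all
    fix p assume p: "p dvd X0 * U" "p dvd \<xi> * U" "p dvd Y"
    show "is_unit p"
      using dvd_of_dvd_coprime_multiples[OF cop(1) p(1,2)] p(3) cop(2) coprime_common_divisor by blast
  qed (use h hom in auto)
qed

end

theorem theorem6:
  fixes \<alpha> \<beta> \<gamma> :: "nat \<Rightarrow> complex" and F :: projmap and d :: "nat \<Rightarrow> nat"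
  defines "F \<equiv> proj_extension \<alpha> \<beta> \<gamma>"
    and "d \<equiv> (\<lambda>n. proj_degree (proj_iterate F n))"
  assumes "(\<gamma> 1, \<gamma> 2) \<noteq> (0, 0)"
    and "birational (affine_map \<alpha> \<beta> \<gamma>)"
    and "\<beta> 1 * \<gamma> 2 - \<beta> 2 * \<gamma> 1 = 0"
    and "\<gamma> 1 * \<gamma> 2 \<noteq> 0"
  shows "(\<alpha> 1 \<noteq> 0 \<and> \<alpha> 2 \<noteq> 0 \<and> has_dynamical_degree F 2 \<and> (\<forall>n. d n = 2 ^ n)) \<or>
         (\<alpha> 1 = 0 \<and> has_dynamical_degree F ((1 + sqrt 5) / 2) \<and>
            (\<forall>n. d (n + 2) = d (n + 1) + d n)) \<or>
         (\<alpha> 2 = 0 \<and> has_dynamical_degree F 1 \<and> (\<forall>n. d n = 1 + n))"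
proof -
  define t c where "t = \<beta> 1 / \<gamma> 1" and "c = \<beta> 0 - t * \<gamma> 0"
  have \<gamma>: "\<gamma> 1 \<noteq> 0" "\<gamma> 2 \<noteq> 0" using assms(6) by auto
  have \<beta>: "\<beta> 0 = t * \<gamma> 0 + c" "\<beta> 1 = t * \<gamma> 1" "\<beta> 2 = t * \<gamma> 2"
    using \<gamma> assms(5) by (simp_all add: t_def c_def field_simps)
  have "c \<noteq> 0" using birational_second_component_nonconstant[OF assms(4), of t] \<beta> by simp
  interpret parallel_fraction \<alpha> \<beta> \<gamma> t c
    using \<gamma> \<beta> \<open>c \<noteq> 0\<close> by unfold_locales
  have dyn: "has_dynamical_degree F r"
    if "r \<ge> 0" "\<And>n. r ^ n \<le> d n" "\<And>n. d n \<le> (real n + 1) * r ^ n" for r :: real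
    using root_tendsto_growth_rate[of r d] that unfolding has_dynamical_degree_def d_def by simp
  consider "\<alpha> 1 \<noteq> 0" "\<alpha> 2 \<noteq> 0" | "\<alpha> 1 = 0" "\<alpha> 2 \<noteq> 0" | "\<alpha> 1 \<noteq> 0" "\<alpha> 2 = 0"
    using birational_first_component_nonconstant[OF assms(4)] by blast
  then show ?thesis
  proof cases
    case 1
    then have d: "d n = 2 ^ n" for n unfolding d_def F_def by (rule degree_generic)
    have "has_dynamical_degree F 2" by (rule dyn) (simp_all add: d)
    then show ?thesis by (intro disjI1 conjI allI 1 d)
  next
    case 2
    then have d: "d n = fib (n + 2)" for n unfolding d_def F_def by (rule degree_\<alpha>1_zero)
    have "has_dynamical_degree F ((1 + sqrt 5) / 2)"
    proof (rule dyn)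
      show "0 \<le> (1 + sqrt 5) / 2" by simp
      show "((1 + sqrt 5) / 2) ^ n \<le> d n" "d n \<le> (real n + 1) * ((1 + sqrt 5) / 2) ^ n" for n
        unfolding d using fib_growth[of n] by blast+
    qed
    moreover have "d (n + 2) = d (n + 1) + d n" for n
      unfolding d by (simp add: numeral_2_eq_2)
    ultimately show ?thesis by (intro disjI2[OF disjI1] conjI allI 2)
  next
    case 3
    then have d: "d n = 1 + n" for n
      unfolding d_def F_def using degree_\<alpha>2_zero by simp
    have "has_dynamical_degree F 1" by (rule dyn) (simp_all add: d)
    then show ?thesis by (intro disjI2[OF disjI2] conjI allI 3 d)
  qed
qed

end
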